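(* Let $p$ be a prime and let $\Gamma=\Gamma(D_{2p^2})$ be the intersection graph of $D_{2p^2}$, with vertex sets $H_i$, $H_p^i$, $H_{1,p}$ as in the context. Then for a vertex $v$, $\operatorname{ecc}(v)=2$ if $v\in H_{1,p}$ or $v=H_p^i$ for some $i$, and $\operatorname{ecc}(v)=3$ if $v\in H_i$ for some $i\in\{1,\dots,p\}$.
   Context: $D_{2n}=\langle r,s : r^n=s^2=1,\ srs=r^{-1}\rangle$ is the dihedral group of order $2n$. The intersection graph $\Gamma(G)$ of a finite group $G$ has as vertices the proper non-trivial subgroups of $G$, two distinct vertices being adjacent iff their intersection is non-trivial. For $n=p^2$ the vertex set of $\Gamma(D_{2p^2})$ is the disjoint union of $H_i=\{\langle sr^{i+lp}\rangle : 1\le l\le p\}$ ($i=1,\dots,p$), the subgroups $H_p^i=\langle r^p, sr^i\rangle$ ($i=1,\dots,p$), and $H_{1,p}=\{\langle r\rangle,\langle r^p\rangle\}$. The eccentricity $\operatorname{ecc}(v)$ is the largest distance from $v$ to any other vertex. *)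

theory Defs
  imports
    "HOL-Algebra.Generated_Groups"
    "HOL-Computational_Algebra.Primes"
    "Graph_Theory.Pair_Digraph"
    "Graph_Theory.Shortest_Path"
begin

section \<open>The dihedral group\<close>

text \<open>
  The presentation \<open>\<langle>r, s : r^n = s^2 = 1, srs = r^{-1}\<rangle>\<close> defines a group of order \<open>2n\<close>, and any
  group generated by elements satisfying these relations is a quotient of it. Hence the groups
  below are exactly those isomorphic to it, with \<open>r\<close> and \<open>s\<close> the images of the generators.
\<close>

locale dihedral_group = group G for G (structure) +
  fixes n :: nat and r s :: 'a
  assumes n_pos: "0 < n"
    and r_closed: "r \<in> carrier G" and s_closed: "s \<in> carrier G"
    and generators: "generate G {r, s} = carrier G"
    and r_pow: "r [^] n = \<one>"
    and s_pow: "s [^] (2::nat) = \<one>"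
    and conj_r: "s \<otimes> r \<otimes> s = inv r"
    and order_G: "order G = 2 * n"

text \<open>The pair \<open>(a, b)\<close> stands for \<open>r^a\<close> if \<open>b\<close> is false, and for \<open>r^a s\<close> otherwise.\<close>

lemma dihedral_group_exists:
  assumes "0 < n"
  shows "\<exists>(G :: (int \<times> bool) monoid) r s. dihedral_group G n r s"
proof -
  define N where "N = int n"
  have N: "N > 0" using assms by (simp add: N_def)
  define G :: "(int \<times> bool) monoid" where
    "G = \<lparr> carrier = {0..<N} \<times> UNIV,
           monoid.mult = (\<lambda>(a, b) (c, d). ((if b then a - c else a + c) mod N, b \<noteq> d)),
           monoid.one = (0, False) \<rparr>"
  define r where "r = (1 mod N, False)"
  define s where "s = (0 :: int, True)"
  have carr: "carrier G = {0..<N} \<times> UNIV" and one: "\<one>\<^bsub>G\<^esub> = (0, False)"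
    and mult: "(a, b) \<otimes>\<^bsub>G\<^esub> (c, d) = ((if b then a - c else a + c) mod N, b \<noteq> d)" for a b c d
    by (simp_all add: G_def)
  interpret group G
  proof (rule groupI)
    fix x assume x: "x \<in> carrier G"
    obtain a b where ab: "x = (a, b)" by (cases x)
    show "\<one>\<^bsub>G\<^esub> \<otimes>\<^bsub>G\<^esub> x = x"
      using x by (simp add: ab carr one mult)
    have "(if b then a else (- a) mod N, b) \<otimes>\<^bsub>G\<^esub> x = \<one>\<^bsub>G\<^esub>"
      by (simp add: ab mult one mod_simps)
    moreover have "(if b then a else (- a) mod N, b) \<in> carrier G"
      using x N by (simp add: ab carr)
    ultimately show "\<exists>y\<in>carrier G. y \<otimes>\<^bsub>G\<^esub> x = \<one>\<^bsub>G\<^esub>" by blast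
  next
    fix x y assume "x \<in> carrier G" "y \<in> carrier G"
    show "x \<otimes>\<^bsub>G\<^esub> y \<in> carrier G"
      using N by (cases x; cases y) (simp add: carr mult)
  next
    fix x y z :: "int \<times> bool"
    obtain a b c d e f where xyz: "x = (a, b)" "y = (c, d)" "z = (e, f)"
      by (metis surj_pair)
    show "x \<otimes>\<^bsub>G\<^esub> y \<otimes>\<^bsub>G\<^esub> z = x \<otimes>\<^bsub>G\<^esub> (y \<otimes>\<^bsub>G\<^esub> z)"
      by (cases b; cases d) (simp_all add: xyz mult mod_simps algebra_simps)
  qed (use N in \<open>simp add: carr one\<close>)
  have rs: "r \<in> carrier G" "s \<in> carrier G"
    using N by (auto simp: r_def s_def carr)
  have r_pow: "r [^]\<^bsub>G\<^esub> k = (int k mod N, False)" for k :: nat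
    by (induction k) (simp_all add: one r_def mult mod_simps add.commute)
  have "carrier G \<subseteq> generate G {r, s}"
  proof
    fix x assume x: "x \<in> carrier G"
    obtain a b where ab: "x = (a, b)" by (cases x)
    have rk: "r [^]\<^bsub>G\<^esub> k \<in> generate G {r, s}" for k :: nat
      by (induction k) (auto intro: generate.intros)
    have a: "0 \<le> a" "a < N" using x by (auto simp: ab carr)
    hence ra: "r [^]\<^bsub>G\<^esub> nat a = (a, False)" by (simp add: r_pow)
    have "x = (if b then (a, False) \<otimes>\<^bsub>G\<^esub> s else (a, False))"
      using a by (simp add: ab s_def mult)
    thus "x \<in> generate G {r, s}"
      using rk[of "nat a"] by (auto simp: ra intro: generate.intros)
  qed
  moreover have "generate G {r, s} \<subseteq> carrier G"
    using rs by (intro generate_incl) auto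
  moreover have "inv\<^bsub>G\<^esub> r = s \<otimes>\<^bsub>G\<^esub> r \<otimes>\<^bsub>G\<^esub> s"
    using rs N by (intro inv_equality) (auto simp: r_def s_def carr mult one mod_simps)
  moreover have "order G = 2 * n"
    by (simp add: order_def carr card_cartesian_product N_def UNIV_bool)
  ultimately have "dihedral_group G n r s"
    using rs assms
    by unfold_locales (auto simp: r_pow one N_def s_def mult numeral_2_eq_2)
  thus ?thesis by blast
qed

section \<open>Intersection graph and eccentricity\<close>

text \<open>Simple graphs are symmetric loop-free digraphs whose arcs are pairs of vertices.\<close>

definition intersection_graph :: "('a, 'm) monoid_scheme \<Rightarrow> 'a set pair_pre_digraph" where
  "intersection_graph G =
    (let V = {H. subgroup H G \<and> H \<noteq> carrier G \<and> H \<noteq> {\<one>\<^bsub>G\<^esub>}}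
     in \<lparr> pverts = V,
          parcs = {(H, K). H \<in> V \<and> K \<in> V \<and> H \<noteq> K \<and> H \<inter> K \<noteq> {\<one>\<^bsub>G\<^esub>}} \<rparr>)"

lemma pair_graph_intersection_graph:
  assumes "finite (carrier G)"
  shows "pair_graph (intersection_graph G)"
proof -
  let ?V = "pverts (intersection_graph G)"
  have V: "finite ?V"
    by (rule finite_subset[of _ "Pow (carrier G)"])
       (use assms in \<open>auto simp: intersection_graph_def dest: subgroup.subset\<close>)
  have E: "parcs (intersection_graph G) \<subseteq> ?V \<times> ?V"
    by (auto simp: intersection_graph_def Let_def)
  have fin: "finite (parcs (intersection_graph G))"
    by (rule finite_subset[OF E]) (use V in simp)
  have loopfree: "fst e \<noteq> snd e" if "e \<in> parcs (intersection_graph G)" for e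
    using that by (auto simp: intersection_graph_def Let_def)
  have "sym (parcs (intersection_graph G))"
    unfolding sym_def by (simp add: intersection_graph_def Let_def Int_commute) blast
  hence sym: "symmetric (with_proj (intersection_graph G))"
    by (simp add: symmetric_def)
  interpret pair_fin_digraph "intersection_graph G"
    by (standard; use E V fin in fastforce)
  show ?thesis
    by (standard; fact loopfree sym)
qed

definition gdist :: "('v, 'e) pre_digraph \<Rightarrow> 'v \<Rightarrow> 'v \<Rightarrow> ereal" where
  "gdist \<Gamma> u v = wf_digraph.\<mu> \<Gamma> (\<lambda>_. 1) u v"

text \<open>Only meaningful for finite graphs with at least two vertices.\<close>

definition ecc :: "('v, 'e) pre_digraph \<Rightarrow> 'v \<Rightarrow> ereal" where
  "ecc \<Gamma> v = Max (gdist \<Gamma> v ` (verts \<Gamma> - {v}))"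

section \<open>The vertices of the intersection graph for \<open>n = p^2\<close>\<close>

text \<open>
  In order, these are the families \<open>H_i\<close> and \<open>H_{1,p}\<close>, and the single subgroup \<open>H_p^i\<close>
  (in which \<open>i\<close> is an upper index, not an exponent).
\<close>

definition H_refl :: "('a, 'm) monoid_scheme \<Rightarrow> 'a \<Rightarrow> 'a \<Rightarrow> nat \<Rightarrow> nat \<Rightarrow> 'a set set" where
  "H_refl G r s p i = {generate G {s \<otimes>\<^bsub>G\<^esub> r [^]\<^bsub>G\<^esub> (i + l * p)} | l. l \<in> {1..p}}"

definition H_rot :: "('a, 'm) monoid_scheme \<Rightarrow> 'a \<Rightarrow> nat \<Rightarrow> 'a set set" where
  "H_rot G r p = {generate G {r}, generate G {r [^]\<^bsub>G\<^esub> p}}"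

definition H_dih :: "('a, 'm) monoid_scheme \<Rightarrow> 'a \<Rightarrow> 'a \<Rightarrow> nat \<Rightarrow> nat \<Rightarrow> 'a set" where
  "H_dih G r s p i = generate G {r [^]\<^bsub>G\<^esub> p, s \<otimes>\<^bsub>G\<^esub> r [^]\<^bsub>G\<^esub> i}"

end

theory Submission
  imports Defs
begin

text \<open>
  Every vertex either contains \<open>r^p\<close> or is generated by one reflection. The vertices containing
  \<open>r^p\<close> are pairwise adjacent, and every reflection \<open>sr^j\<close> lies in the proper subgroup
  \<open>\<langle>r^p, sr^j\<rangle>\<close> of this kind, so all distances are at most 3, and at most 2 from a vertex containing
  \<open>r^p\<close>. The bounds are attained because \<open>sr^j\<close> and \<open>sr^{j+1}\<close> generate the whole group:
  a proper subgroup misses some reflection, and \<open>\<langle>sr^j\<rangle>\<close>, \<open>\<langle>sr^{j+1}\<rangle>\<close> have no common neighbour.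
\<close>

section \<open>Distances as powers of the arc relation\<close>

context pair_wf_digraph
begin

lemma awalk_imp_relpow:
  "awalk u q v \<Longrightarrow> (u, v) \<in> parcs G ^^ length q"
proof (induction q arbitrary: u)
  case Nil
  thus ?case by (simp add: awalk_Nil_iff)
next
  case (Cons e q)
  hence "e \<in> parcs G" "u = fst e" "(snd e, v) \<in> parcs G ^^ length q"
    by (auto simp: awalk_Cons_iff)
  thus ?case by (metis length_Cons prod.collapse relpow_Suc_I2)
qed

text \<open>The vertex hypothesis matters for \<open>k = 0\<close>: the zeroth power is the identity
  on the whole type, while an empty walk must sit at a vertex.\<close>

lemma relpow_imp_awalk:
  assumes "(u, v) \<in> parcs G ^^ k" "u \<in> pverts G"
  shows "\<exists>q. awalk u q v \<and> length q = k"
  using assms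
proof (induction k arbitrary: u)
  case 0
  thus ?case by (auto simp: awalk_Nil_iff)
next
  case (Suc k)
  then obtain w where w: "(u, w) \<in> parcs G" "(w, v) \<in> parcs G ^^ k"
    by (meson relpow_Suc_D2)
  with Suc.IH[of w] obtain q where "awalk w q v" "length q = k"
    using in_arcsD2 by blast
  with w show ?case by (intro exI[of _ "(u, w) # q"]) (simp add: awalk_Cons_iff)
qed

lemma awalk_cost_1: "awalk_cost (\<lambda>_. 1) q = length q"
  by (induction q) auto

lemma gdist_le:
  assumes "(u, v) \<in> parcs G ^^ k" "u \<in> pverts G"
  shows "gdist (with_proj G) u v \<le> real k"
  using relpow_imp_awalk[OF assms] min_cost_le_walk_cost[of u _ v "\<lambda>_. 1"]
  by (auto simp: gdist_def awalk_cost_1)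

text \<open>The distance is an infimum over walks in the extended reals, so excluding all shorter
  lengths suffices, even if no walk exists.\<close>

lemma gdist_ge:
  assumes "\<And>j. j < k \<Longrightarrow> (u, v) \<notin> parcs G ^^ j"
  shows "real k \<le> gdist (with_proj G) u v"
  unfolding gdist_def \<mu>_def
proof (rule INF_greatest)
  fix q assume "q \<in> {q. awalk u q v}"
  hence "\<not> length q < k" using assms awalk_imp_relpow by blast
  thus "ereal (real k) \<le> ereal (awalk_cost (\<lambda>_. 1) q)" by (simp add: awalk_cost_1)
qed

end

text \<open>Reduces the maximum to statements about powers of the arc relation; \<open>w\<close> is
  a vertex at which the bound \<open>k\<close> is attained.\<close>

lemma (in pair_fin_digraph) ecc_eqI:
  assumes v: "v \<in> pverts G"
    and upper: "\<And>w. w \<in> pverts G \<Longrightarrow> w \<noteq> v \<Longrightarrow> \<exists>j\<le>k. (v, w) \<in> parcs G ^^ j"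
    and w: "w \<in> pverts G" "w \<noteq> v"
    and lower: "\<And>j. j < k \<Longrightarrow> (v, w) \<notin> parcs G ^^ j"
  shows "ecc (with_proj G) v = real k"
  unfolding ecc_def
proof (rule Max_eqI)
  have le: "gdist (with_proj G) v x \<le> real k" if x: "x \<in> pverts G" "x \<noteq> v" for x
  proof -
    obtain j where "j \<le> k" "(v, x) \<in> parcs G ^^ j" using upper x by blast
    thus ?thesis using gdist_le[OF _ v, of x j] by (meson ereal_less_eq(3) of_nat_mono order_trans)
  qed
  show "y \<le> real k" if "y \<in> gdist (with_proj G) v ` (verts (with_proj G) - {v})" for y
    using that le by auto
  have "gdist (with_proj G) v w = real k"
    using le[OF w] gdist_ge[of k v w] lower by (simp add: antisym)
  thus "ereal (real k) \<in> gdist (with_proj G) v ` (verts (with_proj G) - {v})"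
    using w by force
qed simp

section \<open>Subgroups of dihedral groups\<close>

context dihedral_group
begin

section \<open>Calculation with rotations and reflections\<close>

lemma pow_closed [simp]: "r [^] (a::int) \<in> carrier G"
  using r_closed by simp

lemma s_mult_s: "s \<otimes> s = \<one>"
  using s_pow s_closed by (simp add: numeral_2_eq_2)

lemma s_mult_s_left: "x \<in> carrier G \<Longrightarrow> s \<otimes> (s \<otimes> x) = x"
  using s_closed by (simp add: m_assoc[symmetric] s_mult_s)

lemma pow_mult_pow: "r [^] (a::int) \<otimes> r [^] (b::int) = r [^] (a + b)"
  using r_closed by (simp add: int_pow_mult)

lemma pow_mult_s: "r [^] (a::int) \<otimes> s = s \<otimes> r [^] (- a)"
proof -
  have rs: "r \<otimes> s = s \<otimes> r [^] (-1::int)"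
    using arg_cong[OF conj_r, of "\<lambda>x. s \<otimes> x"] r_closed s_closed
    by (simp add: m_assoc s_mult_s_left int_pow_neg)
  have nat: "r [^] int k \<otimes> s = s \<otimes> r [^] (- int k)" for k
  proof (induction k)
    case 0
    thus ?case using s_closed by simp
  next
    case (Suc k)
    have "r [^] int (Suc k) \<otimes> s = r [^] int k \<otimes> (r \<otimes> s)"
      using pow_mult_pow[of "int k" 1] r_closed s_closed by (simp add: m_assoc[symmetric] add.commute)
    also have "\<dots> = s \<otimes> r [^] (- int k) \<otimes> r [^] (-1::int)"
      using Suc s_closed by (simp add: rs m_assoc[symmetric])
    also have "\<dots> = s \<otimes> r [^] (- int (Suc k))"
      using s_closed by (simp add: m_assoc pow_mult_pow algebra_simps)
    finally show ?case .
  qed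
  show ?thesis
  proof (cases "a \<ge> 0")
    case True
    thus ?thesis using nat[of "nat a"] by simp
  next
    case False
    \<comment> \<open>Inserting \<open>r^a r^(-a)\<close> on the left exposes an inner product whose
      exponent \<open>- a\<close> is positive, where the case already proved applies.\<close>
    have "s \<otimes> r [^] (- a) = r [^] a \<otimes> (r [^] (- a) \<otimes> s) \<otimes> r [^] (- a)"
      using s_closed by (simp add: m_assoc[symmetric] pow_mult_pow)
    also have "r [^] (- a) \<otimes> s = s \<otimes> r [^] a"
      using nat[of "nat (- a)"] False by simp
    also have "r [^] a \<otimes> (s \<otimes> r [^] a) \<otimes> r [^] (- a) = r [^] a \<otimes> s"
      using s_closed by (simp add: m_assoc pow_mult_pow)
    finally show ?thesis ..
  qed
qed

lemma pow_mult_refl: "r [^] (a::int) \<otimes> (s \<otimes> r [^] (b::int)) = s \<otimes> r [^] (b - a)"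
proof -
  have "r [^] a \<otimes> (s \<otimes> r [^] b) = s \<otimes> r [^] (- a) \<otimes> r [^] b"
    using s_closed by (simp add: m_assoc[symmetric] pow_mult_s)
  thus ?thesis using s_closed by (simp add: m_assoc pow_mult_pow)
qed

lemma refl_mult_pow: "(s \<otimes> r [^] (a::int)) \<otimes> r [^] (b::int) = s \<otimes> r [^] (a + b)"
  using s_closed by (simp add: m_assoc pow_mult_pow)

lemma refl_mult_refl: "(s \<otimes> r [^] (a::int)) \<otimes> (s \<otimes> r [^] (b::int)) = r [^] (b - a)"
  using s_closed by (simp add: m_assoc pow_mult_refl s_mult_s_left)

lemma inv_refl: "inv (s \<otimes> r [^] (a::int)) = s \<otimes> r [^] a"
  using s_closed by (intro inv_equality) (simp_all add: refl_mult_refl)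

lemma inv_pow: "inv (r [^] (a::int)) = r [^] (- a)"
  using r_closed by (simp add: int_pow_neg)

text \<open>This is the subgroup generated by \<open>r^m\<close> and \<open>s r^j\<close>, listed
  explicitly so that membership becomes divisibility of exponents and its size can be
  bounded.\<close>

definition dih_set :: "int \<Rightarrow> int \<Rightarrow> 'a set" where
  "dih_set m j = range (\<lambda>a. r [^] (m * a)) \<union> range (\<lambda>a. s \<otimes> r [^] (j + m * a))"

lemma dih_set_powI: "m dvd a \<Longrightarrow> r [^] a \<in> dih_set m j"
  by (auto simp: dih_set_def)

lemma dih_set_reflI: "m dvd a - j \<Longrightarrow> s \<otimes> r [^] a \<in> dih_set m j"
  by (auto simp: dih_set_def dvd_def algebra_simps)

lemma dih_setE:
  assumes "x \<in> dih_set m j"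
  obtains a where "x = r [^] a" "m dvd a" | a where "x = s \<otimes> r [^] a" "m dvd a - j"
  using assms by (auto simp: dih_set_def)

lemma subgroup_dih_set: "subgroup (dih_set m j) G"
proof (rule subgroupI)
  show "dih_set m j \<subseteq> carrier G"
    using s_closed by (auto simp: dih_set_def)
  show "dih_set m j \<noteq> {}" by (auto simp: dih_set_def)
  show "inv x \<in> dih_set m j" if "x \<in> dih_set m j" for x
    using that by (rule dih_setE) (auto simp: inv_pow inv_refl intro: dih_set_powI dih_set_reflI)
  show "x \<otimes> y \<in> dih_set m j" if x: "x \<in> dih_set m j" and y: "y \<in> dih_set m j" for x y
  proof -
    \<comment> \<open>\<open>*\<close> handles a rotation times a reflection in either order,
      \<open>**\<close> a product of two reflections.\<close>
    have *: "m dvd a + b - j \<and> m dvd b - a - j" if "m dvd a" "m dvd b - j" for a b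
      using that dvd_add[of m a "b - j"] dvd_diff[of m "b - j" a] by (simp add: algebra_simps)
    have **: "m dvd b - a" if "m dvd a - j" "m dvd b - j" for a b
      using dvd_diff[OF that(2,1)] by simp
    from x show ?thesis
    proof (cases rule: dih_setE)
      case x: (1 a)
      from y show ?thesis
        by (cases rule: dih_setE)
           (use x * in \<open>simp_all add: pow_mult_pow pow_mult_refl dih_set_powI dih_set_reflI\<close>)
    next
      case x: (2 a)
      from y show ?thesis
        by (cases rule: dih_setE)
           (use x * ** in \<open>simp_all add: refl_mult_pow refl_mult_refl dih_set_powI dih_set_reflI
              add.commute\<close>)
    qed
  qed
qed

section \<open>Size bounds and the normal form of elements\<close>

lemma card_range_pow:
  assumes "r [^] (m * int k) = \<one>" "k > 0"
  shows "finite (range (\<lambda>a. r [^] (m * a)))" "card (range (\<lambda>a. r [^] (m * a))) \<le> k"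
proof -
  have "r [^] (m * a) = r [^] (m * (a mod int k))" for a
  proof -
    \<comment> \<open>Division with remainder splits off a power of \<open>r^(m k) = 1\<close>,
      leaving at most \<open>k\<close> exponents.\<close>
    have "m * a = m * int k * (a div int k) + m * (a mod int k)"
      by (metis distrib_left mult.assoc mult_div_mod_eq)
    hence "r [^] (m * a) = (r [^] (m * int k)) [^] (a div int k) \<otimes> r [^] (m * (a mod int k))"
      using r_closed by (simp add: int_pow_pow int_pow_mult)
    thus ?thesis using assms by simp
  qed
  hence sub: "range (\<lambda>a. r [^] (m * a)) \<subseteq> (\<lambda>a. r [^] (m * a)) ` {0..<int k}"
    using assms(2) by (auto intro!: image_eqI[of _ _ "_ mod int k"])
  thus "finite (range (\<lambda>a. r [^] (m * a)))" by (rule finite_subset) simp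
  have "card (range (\<lambda>a. r [^] (m * a))) \<le> card ((\<lambda>a. r [^] (m * a)) ` {0..<int k})"
    by (intro card_mono sub) simp
  also have "\<dots> \<le> k" using card_image_le[of "{0..<int k}"] by fastforce
  finally show "card (range (\<lambda>a. r [^] (m * a))) \<le> k" .
qed

lemma card_dih_set:
  assumes "r [^] (m * int k) = \<one>" "k > 0"
  shows "card (dih_set m j) \<le> 2 * k"
proof -
  let ?R = "range (\<lambda>a. r [^] (m * a))"
  \<comment> \<open>The reflections form a left translate of the rotations, so each half has at most
    \<open>k\<close> elements.\<close>
  have eq: "dih_set m j = ?R \<union> (\<lambda>x. s \<otimes> r [^] j \<otimes> x) ` ?R"
    using s_closed by (auto simp: dih_set_def image_iff m_assoc pow_mult_pow)
  have "card (dih_set m j) \<le> card ?R + card ((\<lambda>x. s \<otimes> r [^] j \<otimes> x) ` ?R)"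
    unfolding eq by (rule card_Un_le)
  also have "\<dots> \<le> k + k"
    using card_range_pow[OF assms] card_image_le[of ?R "\<lambda>x. s \<otimes> r [^] j \<otimes> x"] by linarith
  finally show ?thesis by simp
qed

lemma carrier_subset:
  assumes "subgroup K G" "r \<in> K" "s \<in> K"
  shows "K = carrier G"
  using generate_subgroup_incl[of "{r, s}" K] assms generators subgroup.subset[of K G] by auto

lemma carrier_eq_dih_set: "carrier G = dih_set 1 0"
  using carrier_subset[OF subgroup_dih_set, of 1 0] dih_set_powI[of 1 1 0] dih_set_reflI[of 1 0 0]
    r_closed s_closed by simp

lemma carrier_cases:
  assumes "x \<in> carrier G"
  obtains a :: int where "x = r [^] a" | a :: int where "x = s \<otimes> r [^] a"
  using assms by (auto simp: carrier_eq_dih_set elim: dih_setE)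

lemma r_int_pow_n: "r [^] int n = \<one>"
  using r_pow by (simp add: int_pow_int)

text \<open>Otherwise the whole group, being \<open>dih_set 1 0\<close>, would have at most
  \<open>2 * k < 2 * n\<close> elements.\<close>

lemma pow_neq_one:
  assumes "0 < k" "k < n"
  shows "r [^] int k \<noteq> \<one>"
  using card_dih_set[of 1 k 0] assms order_G by (auto simp: carrier_eq_dih_set order_def)

text \<open>Otherwise \<open>s\<close>, and with it every element, is a power of \<open>r\<close>,
  leaving at most \<open>n\<close> elements instead of \<open>2 * n\<close>.\<close>

lemma refl_neq_one: "s \<otimes> r [^] (a::int) \<noteq> \<one>"
proof
  assume "s \<otimes> r [^] a = \<one>"
  hence s: "s = r [^] (- a)"
    using s_closed pow_closed inv_equality inv_pow by metis
  let ?R = "range (\<lambda>a. r [^] (1 * a :: int))"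
  have sub: "carrier G \<subseteq> ?R"
    by (rule subsetI, erule carrier_cases) (simp_all add: s pow_mult_pow)
  have R: "finite ?R" "card ?R \<le> n"
    using card_range_pow[of 1 n] r_int_pow_n n_pos by simp_all
  have "order G \<le> n"
    unfolding order_def using card_mono[OF R(1) sub] R(2) by (rule order_trans)
  thus False using order_G n_pos by simp
qed

lemma finite_carrier: "finite (carrier G)"
  using order_G n_pos by (intro card_ge_0_finite) (simp add: order_def)

text \<open>The product of the two reflections is \<open>r\<close>, and then \<open>s\<close> is
  recovered from either. Both lower bounds on eccentricities rest on this.\<close>

lemma subgroup_with_consecutive_refls:
  assumes K: "subgroup K G" and "s \<otimes> r [^] (a::int) \<in> K" "s \<otimes> r [^] (a + 1) \<in> K"
  shows "K = carrier G"
proof (rule carrier_subset[OF K])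
  have "(s \<otimes> r [^] a) \<otimes> (s \<otimes> r [^] (a + 1)) \<in> K"
    using subgroup.m_closed[OF assms] .
  thus r: "r \<in> K" using r_closed by (simp add: refl_mult_refl)
  have "s \<otimes> r [^] a \<otimes> r [^] (- a) \<in> K"
    using subgroup.m_closed[OF K assms(2) subgroup_int_pow_closed[OF K r]] .
  thus "s \<in> K" using s_closed by (simp add: refl_mult_pow)
qed

lemma subgroup_pair_refl: "subgroup {\<one>, s \<otimes> r [^] (a::int)} G"
  using s_closed by (intro subgroupI) (auto simp: inv_refl refl_mult_refl)

lemma generate_refl: "generate G {s \<otimes> r [^] (a::int)} = {\<one>, s \<otimes> r [^] a}"
  using generate_subgroup_incl[OF _ subgroup_pair_refl, of "{s \<otimes> r [^] a}" a]
  by (auto intro: generate.one generate.incl)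

text \<open>The product of two reflections in \<open>K\<close> is a rotation in \<open>K\<close>,
  hence trivial, so \<open>K\<close> contains only one reflection.\<close>

lemma subgroup_without_rotations:
  assumes K: "subgroup K G" "K \<noteq> {\<one>}" and rot: "\<And>a::int. r [^] a \<in> K \<Longrightarrow> r [^] a = \<one>"
  obtains a :: int where "K = {\<one>, s \<otimes> r [^] a}"
proof -
  have one: "\<one> \<in> K" using K by (simp add: subgroup.one_closed)
  then obtain x where x: "x \<in> K" "x \<noteq> \<one>" using K(2) by blast
  hence "x \<in> carrier G" using subgroup.mem_carrier[OF K(1)] by simp
  then obtain a :: int where a: "x = s \<otimes> r [^] a"
  proof (cases rule: carrier_cases)
    case (1 a)
    thus ?thesis using x rot by blast
  qed
  have "y \<in> {\<one>, x}" if y: "y \<in> K" for y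
  proof -
    have "y \<in> carrier G" using subgroup.mem_carrier[OF K(1) y] .
    thus ?thesis
    proof (cases rule: carrier_cases)
      case (1 b)
      thus ?thesis using y rot by blast
    next
      case (2 b)
      have "x \<otimes> y = \<one>"
        using rot[of "b - a"] subgroup.m_closed[OF K(1) x(1) y] by (simp add: 2 a refl_mult_refl)
      hence "x = inv y"
        using \<open>x \<in> carrier G\<close> \<open>y \<in> carrier G\<close> by (simp add: inv_equality)
      thus ?thesis by (simp add: 2 inv_refl)
    qed
  qed
  hence "K = {\<one>, s \<otimes> r [^] a}" using one x a by blast
  thus ?thesis by (rule that)
qed

end

section \<open>The intersection graph for \<open>n = p^2\<close>\<close>

locale dihedral_prime_square = dihedral_group G "p\<^sup>2" r s for G (structure) and p r s +
  assumes prime: "prime p"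
begin

abbreviation "V \<equiv> pverts (intersection_graph G)"
abbreviation "E \<equiv> parcs (intersection_graph G)"

sublocale graph: pair_graph "intersection_graph G"
  by (rule pair_graph_intersection_graph[OF finite_carrier])

section \<open>Vertices and arcs\<close>

lemma vertex_iff: "K \<in> V \<longleftrightarrow> subgroup K G \<and> K \<noteq> carrier G \<and> K \<noteq> {\<one>}"
  by (simp add: intersection_graph_def Let_def)

lemma p_gt_1: "p > 1"
  using prime prime_gt_1_nat by blast

lemma arcI:
  assumes "H \<in> V" "K \<in> V" "H \<noteq> K" "x \<in> H" "x \<in> K" "x \<noteq> \<one>"
  shows "(H, K) \<in> E"
  using assms by (auto simp: intersection_graph_def Let_def)

lemma arcD:
  assumes "(H, K) \<in> E"
  obtains x where "H \<in> V" "K \<in> V" "x \<in> H" "x \<in> K" "x \<noteq> \<one>"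
proof -
  from assms have HK: "H \<in> V" "K \<in> V" "H \<inter> K \<noteq> {\<one>}"
    by (auto simp: intersection_graph_def Let_def)
  moreover have "\<one> \<in> H \<inter> K" using HK by (simp add: vertex_iff subgroup.one_closed)
  ultimately obtain x where "x \<in> H" "x \<in> K" "x \<noteq> \<one>" by blast
  thus ?thesis using HK that by blast
qed

lemma pow_p_neq_one: "r [^] int p \<noteq> \<one>"
  using p_gt_1 by (intro pow_neq_one) (auto simp: power2_eq_square)

text \<open>In a cyclic group of order \<open>p^2\<close> every nontrivial subgroup contains the one
  of order \<open>p\<close>. Concretely, \<open>gcd(a, p^2)\<close> is a power of \<open>p\<close>
  other than \<open>p^2\<close>, so it divides \<open>p\<close>.\<close>

lemma pow_p_mem:
  assumes K: "subgroup K G" and a: "r [^] (a::int) \<in> K" "r [^] a \<noteq> \<one>"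
  shows "r [^] int p \<in> K"
proof -
  define d where "d = gcd a (int (p\<^sup>2))"
  have "nat d dvd p ^ 2"
    unfolding d_def by (metis gcd_dvd2 gcd_ge_0_int int_dvd_int_iff int_nat_eq)
  then obtain i where i: "i \<le> 2" "nat d = p ^ i"
    using divides_primepow_nat[OF prime] by blast
  have d: "d = int (p ^ i)" using i by (metis d_def gcd_ge_0_int int_nat_eq)
  have "i \<noteq> 2"
  proof
    assume "i = 2"
    hence "int (p\<^sup>2) dvd a" using d d_def by (metis gcd_dvd1)
    then obtain c where "a = int (p\<^sup>2) * c" by blast
    hence "r [^] a = (r [^] int (p\<^sup>2)) [^] c"
      using r_closed by (simp add: int_pow_pow)
    thus False using a r_int_pow_n by simp
  qed
  hence "i \<le> 1" using i by simp
  hence "d dvd int p" using d le_imp_power_dvd[of i 1 "int p"] by simp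
  then obtain c where c: "int p = d * c" by blast
  \<comment> \<open>Bezout writes \<open>p\<close> as a multiple of \<open>a\<close> plus a multiple
    of \<open>p^2\<close>; the latter vanishes in the exponent of \<open>r\<close>.\<close>
  obtain x y where "x * a + y * int (p\<^sup>2) = d" unfolding d_def using bezout_int by blast
  hence "int p = (x * a + y * int (p\<^sup>2)) * c" using c by simp
  hence "int p = a * (x * c) + int (p\<^sup>2) * (y * c)" by (simp only: distrib_right distrib_left mult_ac)
  hence "r [^] int p = r [^] (a * (x * c) + int (p\<^sup>2) * (y * c))" by (rule arg_cong)
  also have "\<dots> = (r [^] a) [^] (x * c) \<otimes> (r [^] int (p\<^sup>2)) [^] (y * c)"
    using r_closed by (simp add: int_pow_pow int_pow_mult)
  also have "\<dots> = (r [^] a) [^] (x * c)" using r_int_pow_n by simp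
  also have "\<dots> \<in> K" using K a subgroup_int_pow_closed by blast
  finally show ?thesis .
qed

text \<open>By \<open>pow_p_mem\<close>, a vertex without \<open>r^p\<close> has no nontrivial
  rotation, so \<open>subgroup_without_rotations\<close> applies.\<close>

lemma vertex_cases:
  assumes "K \<in> V"
  obtains "r [^] int p \<in> K" | a :: int where "K = {\<one>, s \<otimes> r [^] a}"
proof (cases "r [^] int p \<in> K")
  case False
  have K: "subgroup K G" "K \<noteq> {\<one>}" using assms by (simp_all add: vertex_iff)
  show ?thesis
    using subgroup_without_rotations[OF K] pow_p_mem[OF K(1)] False that(2) by metis
qed (rule that(1))

lemma small_subgroup_vertex:
  assumes "subgroup K G" "card K \<le> 2 * p" "x \<in> K" "x \<noteq> \<one>"
  shows "K \<in> V"
proof -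
  \<comment> \<open>Properness follows by counting, since \<open>2 * p < 2 * p^2\<close>.\<close>
  have "2 * p < order G" using p_gt_1 by (simp add: order_G power2_eq_square)
  thus ?thesis using assms by (auto simp: vertex_iff order_def)
qed

lemma refl_vertex: "{\<one>, s \<otimes> r [^] (a::int)} \<in> V"
  using p_gt_1 refl_neq_one[of a]
  by (intro small_subgroup_vertex[OF subgroup_pair_refl, of _ "s \<otimes> r [^] a"]) auto

lemma dih_set_vertex: "dih_set (int p) a \<in> V"
proof (rule small_subgroup_vertex[OF subgroup_dih_set])
  show "card (dih_set (int p) a) \<le> 2 * p"
    using r_int_pow_n p_gt_1 by (intro card_dih_set) (simp_all add: power2_eq_square)
  show "r [^] int p \<in> dih_set (int p) a" by (intro dih_set_powI) simp
qed (rule pow_p_neq_one)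

lemma refl_dih_set_arc: "({\<one>, s \<otimes> r [^] (a::int)}, dih_set (int p) a) \<in> E"
proof (rule arcI[OF refl_vertex dih_set_vertex])
  have "r [^] int p \<in> dih_set (int p) a" by (intro dih_set_powI) simp
  \<comment> \<open>Adjacent vertices must differ; \<open>r^p\<close> separates these two, because
    equality with a reflection would make another reflection trivial.\<close>
  moreover have "r [^] int p \<noteq> s \<otimes> r [^] a"
  proof -
    have "r [^] int p = s \<otimes> r [^] a \<Longrightarrow> s \<otimes> r [^] (a - int p) = \<one>"
      using refl_mult_pow[of a "- int p"] by (metis pow_mult_pow int_pow_0 add.right_inverse diff_conv_add_uminus)
    thus ?thesis using refl_neq_one by blast
  qed
  ultimately show "{\<one>, s \<otimes> r [^] a} \<noteq> dih_set (int p) a"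
    using pow_p_neq_one by blast
  show "s \<otimes> r [^] a \<in> dih_set (int p) a" by (intro dih_set_reflI) simp
qed (auto simp: refl_neq_one)

section \<open>Distances and eccentricities\<close>

lemma arc_sym: "(H, K) \<in> E \<Longrightarrow> (K, H) \<in> E"
  using graph.arcs_symmetric by blast

text \<open>A hub is a vertex containing \<open>r^p\<close>. Two hubs share \<open>r^p\<close>, and
  a reflection subgroup is reached through the hub \<open>dih_set p a\<close> around it.\<close>

lemma distance_to_hub:
  assumes v: "v \<in> V" "r [^] int p \<in> v" and w: "w \<in> V"
  shows "\<exists>j\<le>2. (v, w) \<in> E ^^ j"
  using w
proof (cases rule: vertex_cases)
  case 1
  hence "v = w \<or> (v, w) \<in> E" using v w arcI pow_p_neq_one by blast
  thus ?thesis
  proof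
    assume "v = w" thus ?thesis by (intro exI[of _ 0]) simp
  next
    assume "(v, w) \<in> E" thus ?thesis by (intro exI[of _ 1]) simp
  qed
next
  case (2 a)
  let ?D = "dih_set (int p) a"
  have Dw: "(?D, w) \<in> E" using refl_dih_set_arc arc_sym 2 by blast
  have "r [^] int p \<in> ?D" by (intro dih_set_powI) simp
  hence "v = ?D \<or> (v, ?D) \<in> E" using v dih_set_vertex arcI pow_p_neq_one by blast
  thus ?thesis
  proof
    assume "v = ?D" thus ?thesis using Dw by (intro exI[of _ 1]) simp
  next
    assume "(v, ?D) \<in> E"
    thus ?thesis using Dw by (intro exI[of _ 2]) (auto simp: numeral_2_eq_2)
  qed
qed

lemma ecc_hub:
  assumes v: "v \<in> V" "r [^] int p \<in> v"
  shows "ecc (with_proj (intersection_graph G)) v = 2"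
proof -
  \<comment> \<open>Were every reflection in \<open>v\<close>, two consecutive ones would force
    \<open>v\<close> to be the whole group. The missing one gives a vertex not adjacent to
    \<open>v\<close>.\<close>
  have "\<exists>a::int. s \<otimes> r [^] a \<notin> v"
    using subgroup_with_consecutive_refls v(1) vertex_iff by blast
  then obtain a :: int where a: "s \<otimes> r [^] a \<notin> v" by blast
  let ?w = "{\<one>, s \<otimes> r [^] a}"
  have "(v, ?w) \<notin> E" using a by (auto elim: arcD)
  moreover have "?w \<noteq> v" using a by auto
  ultimately have "(v, ?w) \<notin> E ^^ j" if "j < 2" for j
    using that by (auto simp: less_2_cases_iff)
  hence "ecc (with_proj (intersection_graph G)) v = ereal (real (2::nat))"
    using graph.ecc_eqI[OF v(1) distance_to_hub[OF v] refl_vertex \<open>?w \<noteq> v\<close>] by blast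
  thus ?thesis by simp
qed

text \<open>One step leads to the hub \<open>dih_set p a\<close>, from which two more suffice; the
  subgroup of the next reflection attains the bound.\<close>

lemma ecc_refl:
  "ecc (with_proj (intersection_graph G)) {\<one>, s \<otimes> r [^] (a::int)} = 3"
proof -
  let ?v = "{\<one>, s \<otimes> r [^] a}" and ?w = "{\<one>, s \<otimes> r [^] (a + 1)}" and ?D = "dih_set (int p) a"
  have upper: "\<exists>j\<le>3. (?v, x) \<in> E ^^ j" if x: "x \<in> V" for x
  proof -
    have "r [^] int p \<in> ?D" by (intro dih_set_powI) simp
    then obtain j where j: "j \<le> 2" "(?D, x) \<in> E ^^ j"
      using distance_to_hub[OF dih_set_vertex _ x] by blast
    have "(?v, x) \<in> E ^^ Suc j" by (rule relpow_Suc_I2[OF refl_dih_set_arc j(2)])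
    moreover have "Suc j \<le> 3" using j(1) by simp
    ultimately show ?thesis by blast
  qed
  have no_common: "\<not> (s \<otimes> r [^] a \<in> K \<and> s \<otimes> r [^] (a + 1) \<in> K)" if "K \<in> V" for K
    using that subgroup_with_consecutive_refls[of K a] by (auto simp: vertex_iff)
  \<comment> \<open>\<open>?v\<close> is itself a vertex containing the first reflection, so it
    cannot contain the second.\<close>
  have neq: "?w \<noteq> ?v"
    using no_common[OF refl_vertex[of a]] by blast
  moreover have "(?v, ?w) \<notin> E"
  proof
    assume "(?v, ?w) \<in> E"
    then obtain x where "x \<in> ?v" "x \<in> ?w" "x \<noteq> \<one>" by (rule arcD)
    thus False using neq by simp
  qed
  moreover have "(?v, ?w) \<notin> E ^^ 2"
  proof
    assume "(?v, ?w) \<in> E ^^ 2"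
    then obtain K where K: "(?v, K) \<in> E" "(K, ?w) \<in> E" by (auto simp: numeral_2_eq_2)
    \<comment> \<open>A nontrivial element shared with a two-element subgroup is its reflection, so
      a common neighbour contains both reflections.\<close>
    from K(1) have "s \<otimes> r [^] a \<in> K" by (rule arcD) simp
    moreover from K(2) have "s \<otimes> r [^] (a + 1) \<in> K" by (rule arcD) simp
    ultimately show False using no_common[OF graph.in_arcsD2[OF K(1)]] by simp
  qed
  ultimately have "(?v, ?w) \<notin> E ^^ j" if "j < 3" for j
  proof -
    have "j = 0 \<or> j = 1 \<or> j = 2" using that by linarith
    thus ?thesis using neq \<open>(?v, ?w) \<notin> E\<close> \<open>(?v, ?w) \<notin> E ^^ 2\<close> by (elim disjE) auto
  qed
  hence "ecc (with_proj (intersection_graph G)) ?v = ereal (real 3)"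
    using graph.ecc_eqI[OF refl_vertex upper refl_vertex neq] by blast
  thus ?thesis by simp
qed

end

theorem theorem2p11:
  fixes G :: "('a, 'm) monoid_scheme" and r s :: 'a and p :: nat and v :: "'a set"
  assumes "prime p"
    and "dihedral_group G (p ^ 2) r s"
    and "v \<in> verts (with_proj (intersection_graph G))"
  shows "(v \<in> H_rot G r p \<or> (\<exists>i\<in>{1..p}. v = H_dih G r s p i)
            \<longrightarrow> ecc (with_proj (intersection_graph G)) v = 2)
       \<and> ((\<exists>i\<in>{1..p}. v \<in> H_refl G r s p i)
            \<longrightarrow> ecc (with_proj (intersection_graph G)) v = 3)"
proof (intro conjI impI)
  interpret dihedral_prime_square G p r s
    using assms by (simp add: dihedral_prime_square_def dihedral_prime_square_axioms_def)
  have v: "v \<in> V" using assms(3) by simp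
  {
    assume "v \<in> H_rot G r p \<or> (\<exists>i\<in>{1..p}. v = H_dih G r s p i)"
    \<comment> \<open>In the other hubs \<open>r^p\<close> is a listed generator; only for
      \<open>generate G {r}\<close> does its membership need an argument.\<close>
    moreover have "r [^]\<^bsub>G\<^esub> int p \<in> generate G {r}"
      using generate_is_subgroup[of "{r}"] r_closed
      by (intro subgroup_int_pow_closed) (auto intro: generate.incl)
    ultimately have "r [^]\<^bsub>G\<^esub> int p \<in> v"
      by (auto simp: H_rot_def H_dih_def int_pow_int intro: generate.incl)
    thus "ecc (with_proj (intersection_graph G)) v = 2" using ecc_hub v by blast
  }
  assume "\<exists>i\<in>{1..p}. v \<in> H_refl G r s p i"
  then obtain k :: nat where "v = generate G {s \<otimes>\<^bsub>G\<^esub> r [^]\<^bsub>G\<^esub> k}"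
    by (auto simp: H_refl_def)
  hence "v = {\<one>\<^bsub>G\<^esub>, s \<otimes>\<^bsub>G\<^esub> r [^]\<^bsub>G\<^esub> int k}"
    using generate_refl[of "int k"] by (simp add: int_pow_int)
  thus "ecc (with_proj (intersection_graph G)) v = 3" using ecc_refl by simp
qed

end
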